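(* There is a constant $C>0$ such that for all $n\in\mathbb{N}$ and every circulant graph of order $n$, the 2-dimensional Weisfeiler-Leman algorithm terminates (i.e. its coloring stabilizes) after at most $C\, d(n)\log(n)$ steps, where $d(n)$ is the number of divisors of $n$.
   Context: Graphs are directed graphs without loops (undirected graphs are the special case of a symmetric edge relation). For a finite group $H$ with neutral element $e$ and $S\subseteq H\setminus\{e\}$, the Cayley graph $\mathrm{Cay}(H,S)$ has vertex set $H$ and edge set $\{(h,sh): h\in H, s\in S\}$. A circulant graph of order $n$ is a Cayley graph over the cyclic group $\mathbb{Z}_n$. The 2-dimensional Weisfeiler-Leman algorithm (2-WL) on a graph $(V,E)$: the initial coloring of $V^2$ colors a pair $(v,w)$ according to which of the following hold: $v=w$, $(v,w)\in E$, $(w,v)\in E$ (so there are at most five colors). In one step, given the current coloring $c$ of $V^2$, each pair $(v_1,v_2)$ receives as new color the multiset $\{\{(c(v_1,v_2),c(v,v_2),c(v_1,v)) : v\in V\}\}$. This refines the partition of $V^2$ into color classes. The algorithm stabilizes (terminates) after $r$ steps, where $r$ is the least number such that the partition of $V^2$ after $r+1$ steps equals the partition after $r$ steps. *)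

theory Defs
  imports
    Complex_Main
    "HOL-Library.Multiset"
    "HOL-Algebra.Elementary_Groups"
    "Graph_Theory.Pair_Digraph"
begin

definition cayley_graph :: "('a, 'b) monoid_scheme \<Rightarrow> 'a set \<Rightarrow> 'a pair_pre_digraph" where
  "cayley_graph H S =
     \<lparr> pverts = carrier H,
       parcs = {(h, s \<otimes>\<^bsub>H\<^esub> h) | h s. h \<in> carrier H \<and> s \<in> S} \<rparr>"

(* For n = 0, integer_mod_group n is the infinite group of integers; only n > 0 is relevant. *)
definition circulant_graph :: "nat \<Rightarrow> int pair_pre_digraph \<Rightarrow> bool" where
  "circulant_graph n G \<longleftrightarrow>
     (\<exists>S. S \<subseteq> carrier (integer_mod_group n) - {\<one>\<^bsub>integer_mod_group n\<^esub>} \<and>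
          G = cayley_graph (integer_mod_group n) S)"

(* Colors are kept as syntactic objects, so that no renaming of colors is needed between rounds. *)
datatype wl_col =
    Init (on_diagonal: bool) (is_edge: bool) (is_reverse_edge: bool)
  | Refine "(wl_col \<times> wl_col \<times> wl_col) multiset"

fun wl_coloring :: "'a pair_pre_digraph \<Rightarrow> nat \<Rightarrow> 'a \<times> 'a \<Rightarrow> wl_col" where
  "wl_coloring G 0 (v, w) = Init (v = w) ((v, w) \<in> parcs G) ((w, v) \<in> parcs G)"
| "wl_coloring G (Suc r) (v1, v2) =
     Refine {# (wl_coloring G r (v1, v2), wl_coloring G r (v, v2), wl_coloring G r (v1, v)).
               v \<in># mset_set (pverts G) #}"

definition wl_partition :: "'a pair_pre_digraph \<Rightarrow> nat \<Rightarrow> ('a \<times> 'a) set set" where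
  "wl_partition G r =
     (\<lambda>p. {q \<in> pverts G \<times> pverts G. wl_coloring G r q = wl_coloring G r p})
       ` (pverts G \<times> pverts G)"

(* The minimum is attained for every finite graph, see wl_stabilizes below. *)
definition wl_steps :: "'a pair_pre_digraph \<Rightarrow> nat" where
  "wl_steps G = (LEAST r. wl_partition G (Suc r) = wl_partition G r)"

lemma pair_digraph_cayley_graph:
  assumes "group H" and fin: "finite (carrier H)" and S: "S \<subseteq> carrier H - {\<one>\<^bsub>H\<^esub>}"
  shows "pair_digraph (cayley_graph H S)"
proof -
  interpret group H by fact
  have sub: "parcs (cayley_graph H S) \<subseteq> carrier H \<times> carrier H"
    using S by (auto simp: cayley_graph_def)
  have noloop: "fst e \<noteq> snd e" if e: "e \<in> parcs (cayley_graph H S)" for e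
  proof -
    obtain h s where hs: "e = (h, s \<otimes>\<^bsub>H\<^esub> h)" "h \<in> carrier H" "s \<in> S"
      using e by (auto simp: cayley_graph_def)
    have "s \<in> carrier H" "s \<noteq> \<one>\<^bsub>H\<^esub>" using hs S by auto
    then have "s \<otimes>\<^bsub>H\<^esub> h \<noteq> h" using hs by simp
    then show ?thesis using hs by auto
  qed
  have "finite (parcs (cayley_graph H S))"
    using sub fin by (meson finite_SigmaI finite_subset)
  moreover have "finite (pverts (cayley_graph H S))"
    using fin by (simp add: cayley_graph_def)
  moreover have "fst e \<in> pverts (cayley_graph H S)" "snd e \<in> pverts (cayley_graph H S)"
    if "e \<in> parcs (cayley_graph H S)" for e
    using that S by (auto simp: cayley_graph_def)
  ultimately show ?thesis
    using noloop by unfold_locales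
qed

lemma pair_digraph_circulant_graph:
  assumes "n > 0" and "circulant_graph n G"
  shows "pair_digraph G" and "card (pverts G) = n"
proof -
  obtain S where S: "S \<subseteq> carrier (integer_mod_group n) - {\<one>\<^bsub>integer_mod_group n\<^esub>}"
    and G: "G = cayley_graph (integer_mod_group n) S"
    using assms(2) by (auto simp: circulant_graph_def)
  show "pair_digraph G" unfolding G
    using assms(1) by (intro pair_digraph_cayley_graph S) (auto simp: carrier_integer_mod_group)
  show "card (pverts G) = n"
    using assms(1) by (simp add: G cayley_graph_def carrier_integer_mod_group)
qed

lemma wl_coloring_Suc_eqD:
  assumes fin: "finite (pverts G)" and p: "p \<in> pverts G \<times> pverts G"
    and eq: "wl_coloring G (Suc r) q = wl_coloring G (Suc r) p"
  shows "wl_coloring G r q = wl_coloring G r p"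
proof -
  obtain v1 v2 w1 w2 where pq: "p = (v1, v2)" "q = (w1, w2)" by (cases p, cases q)
  have "set_mset {# (wl_coloring G r q, wl_coloring G r (v, w2), wl_coloring G r (w1, v)).
             v \<in># mset_set (pverts G) #}
      = set_mset {# (wl_coloring G r p, wl_coloring G r (v, v2), wl_coloring G r (v1, v)).
             v \<in># mset_set (pverts G) #}"
    using eq pq by simp
  then have "fst ` ((\<lambda>v. (wl_coloring G r q, wl_coloring G r (v, w2), wl_coloring G r (w1, v))) ` pverts G)
      = fst ` ((\<lambda>v. (wl_coloring G r p, wl_coloring G r (v, v2), wl_coloring G r (v1, v))) ` pverts G)"
    using fin by simp
  moreover have "pverts G \<noteq> {}" using p by auto
  ultimately show ?thesis by (simp add: image_image image_constant_conv)
qed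

lemma wl_stabilizes:
  assumes fin: "finite (pverts G)"
  shows "wl_partition G (Suc (wl_steps G)) = wl_partition G (wl_steps G)"
proof -
  let ?V = "pverts G \<times> pverts G"
  define R where "R r = {(p, q). p \<in> ?V \<and> q \<in> ?V \<and> wl_coloring G r q = wl_coloring G r p}" for r
  have anti: "R (Suc r) \<subseteq> R r" for r
    unfolding R_def using wl_coloring_Suc_eqD[OF fin] by blast
  have finR: "finite (R r)" for r
    by (rule finite_subset[of _ "?V \<times> ?V"]) (use fin in \<open>auto simp: R_def\<close>)
  have part: "wl_partition G r = (\<lambda>p. R r `` {p}) ` ?V" for r
    unfolding wl_partition_def by (intro image_cong) (auto simp: R_def)
  have "\<exists>r. R (Suc r) = R r"
  proof (rule ccontr)
    assume "\<not> ?thesis"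
    then have less: "card (R (Suc r)) < card (R r)" for r
      using anti finR by (metis psubsetI psubset_card_mono)
    have "card (R r) + r \<le> card (R 0)" for r
    proof (induction r)
      case (Suc r)
      then show ?case using less[of r] by linarith
    qed simp
    from this[of "Suc (card (R 0))"] show False by simp
  qed
  then have "\<exists>r. wl_partition G (Suc r) = wl_partition G r" by (auto simp: part)
  then show ?thesis unfolding wl_steps_def by (rule LeastI_ex)
qed

end

theory Submission
  imports
    Defs
    "HOL-Computational_Algebra.Polynomial"
    "HOL-Computational_Algebra.Primes"
    "HOL-Library.Discrete_Functions"
    "HOL-Number_Theory.Cong"
begin

text \<open>
  The color of a pair of vertices of a circulant graph depends only on the difference of the two
  vertices, so each round yields an equivalence relation on \<open>\<int>\<^sub>n\<close>. One round of the algorithm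
  keeps exactly those pairs \<open>(x, y)\<close> at which all convolutions of two functions that are constant
  on the current classes agree (\<open>wl_refine\<close>, \<open>wl_coloring_circulant\<close>). The bound rests on the action
  of the units of \<open>\<int>\<^sub>n\<close> by multiplication.

  The convolution of class functions is a class function one round later. Hence \<open>s\<close> rounds
  distinguish whatever the \<open>p\<close>-fold convolution power of a class function distinguishes if
  \<open>p \<le> 2 ^ s\<close>. If \<open>p\<close> is a prime that does not divide \<open>n\<close> then, by the Frobenius identity modulo
  \<open>p\<close>, the \<open>p\<close>-th power of the indicator of a class \<open>T\<close> is modulo \<open>p\<close> the indicator of \<open>p T\<close>: this
  is the argument of Schur's theorem on multipliers. Factoring a unit \<open>m < n\<close> into primes shows that
  \<open>2 log n\<close> rounds suffice for the partition to refine its own multiples by all units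
  (\<open>wl_refine_funpow_subset_unit_core\<close>).

  A round that starts with a partition invariant under units ends with one. Such a partition can be
  refined properly only \<open>d(n) log n\<close> times: the units have one orbit for each divisor of \<open>n\<close>, all
  classes that meet an orbit have the same size, and at each proper refinement some class splits, so
  that its smallest part has at most half of its size. The sum of the rounded logarithms of the class
  sizes, one summand for each orbit, therefore drops (\<open>class_potential_strict_mono\<close>).

  The two parts are joined by monotonicity. Let \<open>C\<close> be the coarsest invariant refinement of the
  initial partition \<open>E\<close>. After \<open>L = 2 log n\<close> rounds, \<open>E\<close> has become finer than \<open>C\<close>, so \<open>k + L\<close> rounds
  from \<open>E\<close> give something finer than \<open>k\<close> rounds from \<open>C\<close>. If \<open>k\<close> rounds from \<open>C\<close> reach a stable
  partition, then no number of rounds from \<open>E\<close> can refine it properly, so \<open>E\<close> is stable after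
  \<open>k + L\<close> rounds (\<open>wl_refine_stabilizes\<close>).
\<close>

section \<open>Refinement of partitions of the integers modulo n\<close>

abbreviation Zn :: "nat \<Rightarrow> int set" where
  "Zn n \<equiv> {0..<int n}"

lemma bij_betw_diff_mod:
  fixes d :: int
  assumes "n > 0"
  shows "bij_betw (\<lambda>v. (v - d) mod int n) (Zn n) (Zn n)"
proof (rule bij_betw_byWitness[where f' = "\<lambda>v. (v + d) mod int n"])
qed (use assms in \<open>auto simp: mod_simps\<close>)

lemma bij_betw_mult_mod:
  fixes m :: int
  assumes n: "n > 0" and m: "coprime m (int n)"
  shows "bij_betw (\<lambda>v. m * v mod int n) (Zn n) (Zn n)"
proof -
  obtain m' where "[m * m' = 1] (mod int n)"
    using cong_solve_coprime_int[OF m] by auto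
  then have eq: "m * (m' * v) mod int n = v mod int n" "m' * (m * v) mod int n = v mod int n" for v
    by (metis cong_def mod_mult_left_eq mult.assoc mult.commute mult_1)+
  show ?thesis
    by (rule bij_betw_byWitness[where f' = "\<lambda>v. m' * v mod int n"])
       (use n in \<open>auto simp: mod_simps eq\<close>)
qed

definition conv :: "nat \<Rightarrow> (int \<Rightarrow> int) \<Rightarrow> (int \<Rightarrow> int) \<Rightarrow> int \<Rightarrow> int" where
  "conv n f g x = (\<Sum>u\<in>Zn n. f u * g ((x - u) mod int n))"

text \<open>
  In terms of multisets of colors, the condition compares the number of decompositions of \<open>x\<close> and
  of \<open>y\<close> as a sum of elements of two prescribed classes. Quantifying over all pairs of class functions
  instead makes monotonicity and invariance under units immediate, and it turns iterated rounds
  into iterated convolutions.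
\<close>

definition wl_refine :: "nat \<Rightarrow> (int \<times> int) set \<Rightarrow> (int \<times> int) set" where
  "wl_refine n E = {(x, y) \<in> E. \<forall>f g. f respects E \<longrightarrow> g respects E \<longrightarrow> conv n f g x = conv n f g y}"

lemma wl_refine_subset: "wl_refine n E \<subseteq> E"
  by (auto simp: wl_refine_def)

lemma equiv_wl_refine:
  assumes "equiv A E"
  shows "equiv A (wl_refine n E)"
proof (rule equivI)
  have E: "refl_on A E" "sym E" "trans E" "E \<subseteq> A \<times> A"
    using assms by (auto simp: equiv_def)
  show "wl_refine n E \<subseteq> A \<times> A"
    using E wl_refine_subset by blast
  show "refl_on A (wl_refine n E)"
    using E by (auto simp: refl_on_def wl_refine_def)
  show "sym (wl_refine n E)"
    using E(2) by (auto simp: wl_refine_def sym_def)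
  show "trans (wl_refine n E)"
    using E(3) unfolding wl_refine_def trans_def by fastforce
qed

lemma respects_mono: "f respects F \<Longrightarrow> E \<subseteq> F \<Longrightarrow> f respects E"
  by (auto simp: congruent_def)

lemma wl_refine_mono: "E \<subseteq> F \<Longrightarrow> wl_refine n E \<subseteq> wl_refine n F"
  unfolding wl_refine_def using respects_mono by blast

lemma wl_refine_funpow_mono: "E \<subseteq> F \<Longrightarrow> (wl_refine n ^^ k) E \<subseteq> (wl_refine n ^^ k) F"
  by (induction k) (simp_all add: wl_refine_mono)

lemma wl_refine_funpow_antimono:
  "j \<le> k \<Longrightarrow> (wl_refine n ^^ k) E \<subseteq> (wl_refine n ^^ j) E"
proof (induction k rule: dec_induct)
  case (step k)
  then show ?case using wl_refine_subset[of n "(wl_refine n ^^ k) E"] by simp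
qed simp

lemma equiv_wl_refine_funpow: "equiv A E \<Longrightarrow> equiv A ((wl_refine n ^^ k) E)"
  by (induction k) (simp_all add: equiv_wl_refine)

lemma conv_respects_wl_refine:
  "f respects E \<Longrightarrow> g respects E \<Longrightarrow> conv n f g respects wl_refine n E"
  by (auto simp: congruent_def wl_refine_def)

definition kernel_rel :: "'a set \<Rightarrow> ('a \<Rightarrow> 'b) \<Rightarrow> ('a \<times> 'a) set" where
  "kernel_rel A c = {(x, y) \<in> A \<times> A. c x = c y}"

lemma equiv_kernel: "equiv A (kernel_rel A c)"
  by (auto simp: kernel_rel_def intro!: equivI refl_onI symI transI)

text \<open>
  Convolutions of class functions are sums over the multiset of color triples, hence determined by
  it. Conversely, the multiplicity of a triple is a convolution of two indicator functions of color
  classes.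
\<close>

lemma wl_refine_kernel:
  fixes c :: "int \<Rightarrow> 'b"
  assumes n: "n > 0"
  shows "wl_refine n (kernel_rel (Zn n) c) =
    kernel_rel (Zn n) (\<lambda>x. {# (c x, c ((x - u) mod int n), c u). u \<in># mset_set (Zn n) #})"
    (is "?L = kernel_rel _ ?M")
proof -
  have color: "c x = c y" if "?M x = ?M y" for x y
  proof -
    have "set_mset (?M x) = set_mset (?M y)" using that by simp
    then have "fst ` set_mset (?M x) = fst ` set_mset (?M y)" by simp
    then show ?thesis using n by (simp add: image_image image_constant_conv)
  qed
  have convolutions: "conv n f g x = conv n f g y"
    if eq: "?M x = ?M y" and f: "f respects kernel_rel (Zn n) c"
      and g: "g respects kernel_rel (Zn n) c" for f g x y
  proof -
    \<comment> \<open>\<open>h f\<close> is the function on colors through which a class function \<open>f\<close> factors\<close>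
    define h where "h f a = f (SOME v. v \<in> Zn n \<and> c v = a)" for f :: "int \<Rightarrow> int" and a
    have h: "h f (c v) = f v" if "f respects kernel_rel (Zn n) c" "v \<in> Zn n" for f v
    proof -
      have "(SOME v'. v' \<in> Zn n \<and> c v' = c v) \<in> Zn n \<and> c (SOME v'. v' \<in> Zn n \<and> c v' = c v) = c v"
        using that(2) by (intro someI) auto
      then show ?thesis
        using that unfolding h_def congruent_def kernel_rel_def by blast
    qed
    have conv: "conv n f g z = (\<Sum>(_, b, a) \<in># ?M z. h f a * h g b)" for z
    proof -
      have "conv n f g z = (\<Sum>u\<in>Zn n. h f (c u) * h g (c ((z - u) mod int n)))"
        unfolding conv_def using n by (intro sum.cong) (auto simp: h[OF f] h[OF g])
      then show ?thesis
        by (simp add: image_mset.compositionality comp_def sum_unfold_sum_mset)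
    qed
    show ?thesis by (simp add: conv eq)
  qed
  have multisets: "?M x = ?M y" if "(x, y) \<in> ?L" for x y
  proof (rule multiset_eqI)
    fix t :: "'b \<times> 'b \<times> 'b"
    obtain a b d where t: "t = (a, b, d)" by (cases t)
    define f g :: "int \<Rightarrow> int" where "f v = of_bool (c v = d)" and "g v = of_bool (c v = b)" for v
    have count: "int (count (?M z) t) = of_bool (c z = a) * conv n f g z" for z
    proof -
      have "count (?M z) t = (\<Sum>u | u \<in> Zn n \<and> t = (c z, c ((z - u) mod int n), c u). 1)"
        unfolding count_image_mset' by (intro sum.cong) auto
      also have "\<dots> = card {u \<in> Zn n. t = (c z, c ((z - u) mod int n), c u)}"
        by simp
      also have "int \<dots> = (\<Sum>u\<in>Zn n. of_bool (t = (c z, c ((z - u) mod int n), c u)))"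
        by (simp add: Int_def)
      also have "\<dots> = of_bool (c z = a) * conv n f g z"
        unfolding conv_def sum_distrib_left by (intro sum.cong) (auto simp: t f_def g_def of_bool_def)
      finally show ?thesis .
    qed
    have "f respects kernel_rel (Zn n) c" "g respects kernel_rel (Zn n) c"
      by (auto simp: congruent_def kernel_rel_def f_def g_def)
    then have "conv n f g x = conv n f g y" "c x = c y"
      using that by (auto simp: wl_refine_def kernel_rel_def)
    then have "int (count (?M x) t) = int (count (?M y) t)"
      unfolding count by simp
    then show "count (?M x) t = count (?M y) t" by simp
  qed
  show ?thesis
  proof (intro equalityI subrelI)
    fix x y assume xy: "(x, y) \<in> ?L"
    then have "(x, y) \<in> kernel_rel (Zn n) c"
      using wl_refine_subset by blast
    then show "(x, y) \<in> kernel_rel (Zn n) ?M"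
      using multisets[OF xy] unfolding kernel_rel_def by blast
  next
    fix x y assume "(x, y) \<in> kernel_rel (Zn n) ?M"
    then have xy: "x \<in> Zn n" "y \<in> Zn n" and eq: "?M x = ?M y"
      unfolding kernel_rel_def by blast+
    have "(x, y) \<in> kernel_rel (Zn n) c"
      using xy color[OF eq] unfolding kernel_rel_def by blast
    then show "(x, y) \<in> ?L"
      unfolding wl_refine_def using convolutions[OF eq] by blast
  qed
qed

section \<open>The coloring of a circulant graph\<close>

text \<open>
  Translations are automorphisms, so a color is a function of the difference. The substitution
  \<open>u = v - v1\<close> turns the triples of colors of \<open>(v1, v2)\<close>, \<open>(v, v2)\<close>, \<open>(v1, v)\<close> into those of the
  differences \<open>d\<close>, \<open>d - u\<close>, \<open>u\<close> with \<open>d = v2 - v1\<close>.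
\<close>

lemma wl_coloring_circulant:
  assumes n: "n > 0" and S: "S \<subseteq> Zn n"
  defines "G \<equiv> cayley_graph (integer_mod_group n) S"
  defines "E \<equiv> kernel_rel (Zn n) (\<lambda>x. wl_coloring G 0 (0, x))"
  assumes "v1 \<in> Zn n" "v2 \<in> Zn n" "w1 \<in> Zn n" "w2 \<in> Zn n"
  shows "wl_coloring G r (v1, v2) = wl_coloring G r (w1, w2) \<longleftrightarrow>
    ((v2 - v1) mod int n, (w2 - w1) mod int n) \<in> (wl_refine n ^^ r) E"
proof -
  define c where "c r x = wl_coloring G r (0, x)" for r x
  have V: "pverts G = Zn n"
    using n by (simp add: G_def cayley_graph_def carrier_integer_mod_group)
  have arc: "(v, w) \<in> parcs G \<longleftrightarrow> (w - v) mod int n \<in> S" if "v \<in> Zn n" "w \<in> Zn n" for v w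
  proof
    assume "(v, w) \<in> parcs G"
    then show "(w - v) mod int n \<in> S"
      using S by (auto simp: G_def cayley_graph_def mod_simps subset_eq)
  next
    assume "(w - v) mod int n \<in> S"
    moreover have "w = ((w - v) mod int n + v) mod int n"
      using that by (simp add: mod_simps)
    ultimately show "(v, w) \<in> parcs G"
      using that n by (force simp: G_def cayley_graph_def carrier_integer_mod_group)
  qed
  have diff: "wl_coloring G r (v, w) = c r ((w - v) mod int n)" if "v \<in> Zn n" "w \<in> Zn n" for v w r
    using that
  proof (induction r arbitrary: v w)
    case 0
    have "(w - v) mod int n = 0 \<longleftrightarrow> v = w"
      using 0 by (simp add: mod_eq_0_iff_dvd flip: mod_eq_dvd_iff) auto
    then show ?case
      using 0 n by (auto simp: c_def arc mod_simps)
  next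
    case (Suc r)
    have step: "wl_coloring G (Suc r) (v, w) = Refine
      {# (c r ((w - v) mod int n), c r (((w - v) mod int n - u) mod int n), c r u). u \<in># mset_set (Zn n) #}"
      if "v \<in> Zn n" "w \<in> Zn n" for v w
    proof -
      have mset: "image_mset (\<lambda>u. (u - v) mod int n) (mset_set (Zn n)) = mset_set (Zn n)"
        using bij_betw_diff_mod[OF n, of v] by (simp add: bij_betw_def image_mset_mset_set)
      have "wl_coloring G (Suc r) (v, w) = Refine (image_mset
          (\<lambda>v'. (wl_coloring G r (v, w), wl_coloring G r (v', w), wl_coloring G r (v, v'))) (mset_set (Zn n)))"
        by (simp add: V)
      also have "image_mset (\<lambda>v'. (wl_coloring G r (v, w), wl_coloring G r (v', w), wl_coloring G r (v, v'))) (mset_set (Zn n))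
        = image_mset (\<lambda>v'. (c r ((w - v) mod int n),
             c r (((w - v) mod int n - (v' - v) mod int n) mod int n), c r ((v' - v) mod int n))) (mset_set (Zn n))"
        using Suc.IH that by (intro image_mset_cong) (simp add: mod_simps)
      also have "\<dots> = image_mset (\<lambda>u. (c r ((w - v) mod int n), c r (((w - v) mod int n - u) mod int n), c r u))
          (image_mset (\<lambda>u. (u - v) mod int n) (mset_set (Zn n)))"
        by (simp add: image_mset.compositionality comp_def)
      finally show ?thesis
        using mset by simp
    qed
    show ?case unfolding step[OF Suc.prems]
      unfolding c_def using n by (subst step) (auto simp: c_def)
  qed
  have "kernel_rel (Zn n) (c r) = (wl_refine n ^^ r) E" for r
  proof (induction r)
    case 0
    show ?case by (simp add: E_def c_def[abs_def])
  next
    case (Suc r)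
    have step: "c (Suc r) x = Refine
      {# (c r x, c r ((x - u) mod int n), c r u). u \<in># mset_set (Zn n) #}" if "x \<in> Zn n" for x
    proof -
      have "{# (c r x, wl_coloring G r (u, x), c r u). u \<in># mset_set (Zn n) #} =
        {# (c r x, c r ((x - u) mod int n), c r u). u \<in># mset_set (Zn n) #}"
        using diff that by (intro image_mset_cong) simp
      then show ?thesis
        by (simp add: c_def V)
    qed
    have "(wl_refine n ^^ Suc r) E = wl_refine n (kernel_rel (Zn n) (c r))"
      by (simp add: Suc)
    also have "\<dots> = kernel_rel (Zn n) (c (Suc r))"
      unfolding wl_refine_kernel[OF n] by (auto simp: kernel_rel_def step)
    finally show ?case by simp
  qed
  from this[of r, symmetric] show ?thesis
    using assms(5-) n by (simp add: diff kernel_rel_def)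
qed

section \<open>Multiplication by units\<close>

definition unit_invariant :: "nat \<Rightarrow> (int \<times> int) set \<Rightarrow> bool" where
  "unit_invariant n E \<longleftrightarrow>
     (\<forall>m x y. coprime m (int n) \<longrightarrow> (x, y) \<in> E \<longrightarrow> (m * x mod int n, m * y mod int n) \<in> E)"

text \<open>Multiplication by a unit is an automorphism of \<open>\<int>\<^sub>n\<close>, so it commutes with convolution.\<close>

lemma conv_mult_unit:
  assumes "n > 0" "coprime m (int n)"
  shows "conv n f g (m * x mod int n) =
    conv n (\<lambda>u. f (m * u mod int n)) (\<lambda>u. g (m * u mod int n)) x"
proof -
  have "(m * x mod int n - m * u mod int n) mod int n = m * ((x - u) mod int n) mod int n" for u
    by (simp add: mod_simps right_diff_distrib)
  then show ?thesis
    unfolding conv_def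
    by (subst sum.reindex_bij_betw[OF bij_betw_mult_mod[OF assms], symmetric]) simp
qed

lemma unit_invariant_wl_refine:
  assumes n: "n > 0" and inv: "unit_invariant n E"
  shows "unit_invariant n (wl_refine n E)"
  unfolding unit_invariant_def
proof (intro allI impI)
  fix m x y :: int
  assume m: "coprime m (int n)" and xy: "(x, y) \<in> wl_refine n E"
  have comp: "(\<lambda>u. f (m * u mod int n)) respects E" if "f respects E" for f :: "int \<Rightarrow> int"
    using that inv m unfolding congruent_def unit_invariant_def by blast
  have "(m * x mod int n, m * y mod int n) \<in> E"
    using xy inv m wl_refine_subset unfolding unit_invariant_def by blast
  moreover have "conv n f g (m * x mod int n) = conv n f g (m * y mod int n)"
    if "f respects E" "g respects E" for f g
    using xy comp[OF that(1)] comp[OF that(2)]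
    by (simp add: wl_refine_def conv_mult_unit[OF n m])
  ultimately show "(m * x mod int n, m * y mod int n) \<in> wl_refine n E"
    by (simp add: wl_refine_def)
qed

text \<open>The coarsest unit-invariant refinement of \<open>E\<close>.\<close>

definition unit_core :: "nat \<Rightarrow> (int \<times> int) set \<Rightarrow> (int \<times> int) set" where
  "unit_core n E = {(x, y) \<in> Zn n \<times> Zn n.
     \<forall>m. coprime m (int n) \<longrightarrow> (m * x mod int n, m * y mod int n) \<in> E}"

lemma unit_core_subset: "unit_core n E \<subseteq> E"
  by (auto simp: unit_core_def dest: spec[where x = 1])

lemma equiv_unit_core:
  assumes n: "n > 0" and E: "equiv (Zn n) E"
  shows "equiv (Zn n) (unit_core n E)"
proof (rule equivI)
  show "unit_core n E \<subseteq> Zn n \<times> Zn n"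
    by (auto simp: unit_core_def)
  show "refl_on (Zn n) (unit_core n E)"
    using n equiv_class_self[OF E] by (auto simp: unit_core_def refl_on_def)
  have "sym E" "trans E"
    using E by (auto simp: equiv_def)
  then show "sym (unit_core n E)" "trans (unit_core n E)"
    unfolding unit_core_def sym_def trans_def by blast+
qed

lemma unit_invariant_unit_core:
  assumes "n > 0"
  shows "unit_invariant n (unit_core n E)"
  using assms coprime_mult_left_iff
  by (auto simp: unit_invariant_def unit_core_def mod_mult_right_eq simp flip: mult.assoc)

section \<open>Convolution powers and the Frobenius identity\<close>

lemma prime_dvd_power_add_diff:
  fixes x y :: "'a :: comm_ring_1"
  assumes p: "prime p"
  shows "of_nat p dvd (x + y) ^ p - (x ^ p + y ^ p)"
proof -
  have "p > 0" using p by (simp add: prime_gt_0_nat)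
  have "(x + y) ^ p = (\<Sum>k\<le>p. of_nat (p choose k) * x ^ k * y ^ (p - k))"
    by (rule binomial_ring)
  also have "{..p} = insert 0 (insert p {0<..<p})"
    using \<open>p > 0\<close> by auto
  finally have "(x + y) ^ p - (x ^ p + y ^ p)
      = (\<Sum>k\<in>{0<..<p}. of_nat (p choose k) * x ^ k * y ^ (p - k))"
    using \<open>p > 0\<close> by simp
  moreover have "of_nat p dvd (of_nat (p choose k) :: 'a)" if "k \<in> {0<..<p}" for k
    using dvd_choose_prime[of k p] that p by (auto elim!: dvdE)
  then have "of_nat p dvd (\<Sum>k\<in>{0<..<p}. of_nat (p choose k) * x ^ k * y ^ (p - k))"
    by (intro dvd_sum dvd_mult2)
  ultimately show ?thesis by simp
qed

lemma prime_dvd_power_sum_diff: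
  fixes f :: "'b \<Rightarrow> 'a :: comm_ring_1"
  assumes p: "prime p"
  shows "of_nat p dvd (\<Sum>i\<in>A. f i) ^ p - (\<Sum>i\<in>A. f i ^ p)"
proof (induction A rule: infinite_finite_induct)
  case (insert a A)
  have "(\<Sum>i\<in>insert a A. f i) ^ p - (\<Sum>i\<in>insert a A. f i ^ p)
    = ((f a + (\<Sum>i\<in>A. f i)) ^ p - (f a ^ p + (\<Sum>i\<in>A. f i) ^ p))
      + ((\<Sum>i\<in>A. f i) ^ p - (\<Sum>i\<in>A. f i ^ p))"
    using insert by simp
  then show ?case
    using insert.IH prime_dvd_power_add_diff[OF p] by (metis dvd_add)
qed (use p in \<open>auto simp: prime_gt_0_nat zero_power\<close>)

text \<open>
  The coefficient of \<open>X\<^sup>x\<close> in the class of \<open>P\<close> modulo \<open>X\<^sup>n - 1\<close>, computed by Horner's scheme. The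
  polynomial ring carries the powers and the Frobenius identity, and this map sends its product to
  the convolution.
\<close>

definition cyclic_coeff :: "nat \<Rightarrow> int poly \<Rightarrow> int \<Rightarrow> int" where
  "cyclic_coeff n P =
     fold_coeffs (\<lambda>a h x. (if int n dvd x then a else 0) + h (x - 1)) P (\<lambda>_. 0)"

lemma cyclic_coeff_0 [simp]: "cyclic_coeff n 0 x = 0"
  by (simp add: cyclic_coeff_def)

lemma cyclic_coeff_pCons [simp]:
  "cyclic_coeff n (pCons a P) x = (if int n dvd x then a else 0) + cyclic_coeff n P (x - 1)"
  by (cases "a = 0 \<and> P = 0")
     (auto simp: cyclic_coeff_def fold_coeffs_pCons_coeff_not_0_eq fold_coeffs_pCons_not_0_0_eq)

lemma cyclic_coeff_add [simp]:
  "cyclic_coeff n (P + Q) x = cyclic_coeff n P x + cyclic_coeff n Q x"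
  by (induction P Q arbitrary: x rule: poly_induct2) auto

lemma cyclic_coeff_smult [simp]: "cyclic_coeff n (smult c P) x = c * cyclic_coeff n P x"
  by (induction P arbitrary: x) (auto simp: distrib_left)

lemma cyclic_coeff_sum [simp]:
  "cyclic_coeff n (\<Sum>i\<in>A. P i) x = (\<Sum>i\<in>A. cyclic_coeff n (P i) x)"
  by (induction A rule: infinite_finite_induct) auto

lemma cyclic_coeff_monom [simp]:
  "cyclic_coeff n (monom c k) x = (if int n dvd x - int k then c else 0)"
  by (induction k arbitrary: x) (auto simp: monom_0 monom_Suc diff_diff_eq add.commute)

lemma cyclic_coeff_mod [simp]: "cyclic_coeff n P (x mod int n) = cyclic_coeff n P x"
proof (induction P arbitrary: x)
  case (pCons a P)
  have "cyclic_coeff n P (x mod int n - 1) = cyclic_coeff n P ((x mod int n - 1) mod int n)"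
    by (simp add: pCons.IH)
  also have "\<dots> = cyclic_coeff n P (x - 1)"
    by (simp add: mod_simps pCons.IH)
  finally show ?case by (simp add: dvd_mod_iff)
qed simp

lemma cyclic_coeff_mult:
  assumes n: "n > 0"
  shows "cyclic_coeff n (P * Q) x = conv n (cyclic_coeff n P) (cyclic_coeff n Q) x"
proof (induction P arbitrary: x)
  case 0
  show ?case by (simp add: conv_def)
next
  case (pCons a P)
  have "conv n (cyclic_coeff n (pCons a P)) (cyclic_coeff n Q) x =
    (\<Sum>u\<in>Zn n. (if int n dvd u then a else 0) * cyclic_coeff n Q (x - u)) +
    (\<Sum>u\<in>Zn n. cyclic_coeff n P (u - 1) * cyclic_coeff n Q (x - u))"
    by (simp add: conv_def distrib_right sum.distrib)
  also have "(\<Sum>u\<in>Zn n. (if int n dvd u then a else 0) * cyclic_coeff n Q (x - u)) =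
    (\<Sum>u\<in>{0}. a * cyclic_coeff n Q (x - u))"
    using n by (intro sum.mono_neutral_cong_right) (auto dest: zdvd_imp_le)
  also have "(\<Sum>u\<in>Zn n. cyclic_coeff n P (u - 1) * cyclic_coeff n Q (x - u)) =
    (\<Sum>u\<in>Zn n. cyclic_coeff n P ((u - 1) mod int n) * cyclic_coeff n Q (((x - 1) - (u - 1) mod int n) mod int n))"
    by (simp only: mod_diff_right_eq cyclic_coeff_mod) simp
  also have "\<dots> = conv n (cyclic_coeff n P) (cyclic_coeff n Q) (x - 1)"
    unfolding conv_def by (rule sum.reindex_bij_betw[OF bij_betw_diff_mod[OF n]])
  finally show ?case
    by (simp add: pCons.IH)
qed

text \<open>
  Splitting the exponent in halves costs one round for each doubling of the power, so \<open>s\<close> rounds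
  reach all powers up to \<open>2 ^ s\<close>.
\<close>

lemma cyclic_coeff_power_respects:
  assumes n: "n > 0" and P: "cyclic_coeff n P respects E" and k: "0 < k" "k \<le> 2 ^ s"
  shows "cyclic_coeff n (P ^ k) respects (wl_refine n ^^ s) E"
  using k
proof (induction s arbitrary: k)
  case 0
  then have "k = 1" by simp
  then show ?case using P by simp
next
  case (Suc s)
  show ?case
  proof (cases "k = 1")
    case True
    have "(wl_refine n ^^ Suc s) E \<subseteq> E"
      using wl_refine_funpow_antimono[of 0 "Suc s" n E] by simp
    from respects_mono[OF P this] show ?thesis
      using True by simp
  next
    case False
    have split: "P ^ k = P ^ (k div 2) * P ^ (k - k div 2)"
      by (simp flip: power_add)
    have "cyclic_coeff n (P ^ (k div 2)) respects (wl_refine n ^^ s) E"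
      "cyclic_coeff n (P ^ (k - k div 2)) respects (wl_refine n ^^ s) E"
      using False Suc.prems by (auto intro!: Suc.IH)
    then have "conv n (cyclic_coeff n (P ^ (k div 2))) (cyclic_coeff n (P ^ (k - k div 2)))
        respects wl_refine n ((wl_refine n ^^ s) E)"
      by (rule conv_respects_wl_refine)
    moreover have "cyclic_coeff n (P ^ k) =
        conv n (cyclic_coeff n (P ^ (k div 2))) (cyclic_coeff n (P ^ (k - k div 2)))"
      unfolding split using cyclic_coeff_mult[OF n] by blast
    ultimately show ?thesis by simp
  qed
qed

text \<open>
  Let \<open>f\<close> be the indicator of the class of \<open>x\<close>. By the Frobenius identity, the \<open>p\<close>-th convolution
  power of \<open>f\<close> has at \<open>p z\<close> a value congruent to \<open>f z\<close> modulo \<open>p\<close>. It has the same value at \<open>p x\<close> and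
  \<open>p y\<close> by assumption, so \<open>f x\<close> and \<open>f y\<close>, which are 0 or 1, are congruent and hence equal.
\<close>

lemma wl_refine_funpow_prime_multiple:
  assumes n: "n > 0" and E: "equiv (Zn n) E"
    and p: "prime p" "coprime p n" "p \<le> 2 ^ s"
    and xy: "x \<in> Zn n" "y \<in> Zn n"
    and rel: "(int p * x mod int n, int p * y mod int n) \<in> (wl_refine n ^^ s) E"
  shows "(x, y) \<in> E"
proof -
  define f :: "int \<Rightarrow> int" where "f u = of_bool ((x, u) \<in> E)" for u
  define P where "P = (\<Sum>u<n. monom (f (int u)) u)"
  have p0: "p > 0" and p2: "p \<ge> 2"
    using p(1) by (auto simp: prime_gt_0_nat prime_ge_2_nat)
  have pick: "(\<Sum>u<n. if int n dvd z - int u then f (int u) else 0) = f z" if z: "z \<in> Zn n" for z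
  proof -
    have "(\<Sum>u<n. if int n dvd z - int u then f (int u) else 0) = (\<Sum>u\<in>{nat z}. f (int u))"
    proof (rule sum.mono_neutral_cong_right)
      have "u = nat z" if "u < n" "int n dvd z - int u" for u
        using that z by (auto simp flip: mod_eq_dvd_iff)
      then show "\<forall>i\<in>{..<n} - {nat z}. (if int n dvd z - int i then f (int i) else 0) = 0"
        by auto
    qed (use z in auto)
    then show ?thesis using z by simp
  qed
  have coeff_P: "cyclic_coeff n P z = f z" if "z \<in> Zn n" for z
    using pick[OF that] by (simp add: P_def)
  have sub: "E \<subseteq> Zn n \<times> Zn n" and "sym E" "trans E"
    using E by (auto simp: equiv_def)
  have "f respects E"
  proof (rule congruentI)
    fix u v assume "(u, v) \<in> E"
    then have "(x, u) \<in> E \<longleftrightarrow> (x, v) \<in> E"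
      using \<open>sym E\<close> \<open>trans E\<close> by (meson symD transD)
    then show "f u = f v" by (simp add: f_def)
  qed
  have "cyclic_coeff n P respects E"
  proof (rule congruentI)
    fix u v assume uv: "(u, v) \<in> E"
    then have "u \<in> Zn n" "v \<in> Zn n" using sub by blast+
    then show "cyclic_coeff n P u = cyclic_coeff n P v"
      using congruentD[OF \<open>f respects E\<close> uv] by (simp only: coeff_P)
  qed
  from cyclic_coeff_power_respects[OF n this p0 p(3)] rel
  have eq: "cyclic_coeff n (P ^ p) (int p * x mod int n) = cyclic_coeff n (P ^ p) (int p * y mod int n)"
    by (rule congruentD)
  have "of_nat p dvd P ^ p - (\<Sum>u<n. monom (f (int u)) u ^ p)"
    unfolding P_def by (rule prime_dvd_power_sum_diff[OF p(1)])
  moreover have "monom (f (int u)) u ^ p = monom (f (int u)) (u * p)" for u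
    using p0 by (simp add: monom_power f_def)
  ultimately have "of_nat p dvd P ^ p - (\<Sum>u<n. monom (f (int u)) (u * p))"
    by (simp only:)
  then obtain Q where "P ^ p - (\<Sum>u<n. monom (f (int u)) (u * p)) = of_nat p * Q"
    by (rule dvdE)
  moreover have "of_nat p * Q = smult (int p) Q"
    by (simp only: of_nat_poly mult_pCons_left mult_zero_left pCons_0_0 add_0_right)
  ultimately have frob: "P ^ p = smult (int p) Q + (\<Sum>u<n. monom (f (int u)) (u * p))"
    by (simp only: diff_eq_eq)
  have coeff_Pp: "[cyclic_coeff n (P ^ p) (int p * z mod int n) = f z] (mod int p)" if z: "z \<in> Zn n" for z
  proof -
    have "int n dvd int p * z - int (u * p) \<longleftrightarrow> int n dvd z - int u" for u
    proof -
      have "int p * z - int (u * p) = int p * (z - int u)"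
        by (simp add: algebra_simps)
      then show ?thesis
        using p(2) by (simp add: coprime_dvd_mult_right_iff coprime_commute)
    qed
    then have "cyclic_coeff n (P ^ p) (int p * z) = int p * cyclic_coeff n Q (int p * z) + f z"
      using pick[OF z] by (simp add: frob)
    then show ?thesis by (simp add: cong_def)
  qed
  have "[f x = f y] (mod int p)"
    using coeff_Pp[OF xy(1)] coeff_Pp[OF xy(2)] eq by (metis cong_sym cong_trans)
  moreover have "(x, x) \<in> E"
    using equiv_class_self[OF E xy(1)] by simp
  ultimately show ?thesis
    using p2 by (auto simp: f_def cong_def of_bool_def split: if_splits)
qed

text \<open>
  The numbers of rounds for the prime factors add up. A prime \<open>p\<close> needs the least \<open>s\<close> with
  \<open>p \<le> 2 ^ s\<close>, for which \<open>2 ^ s < 2 p \<le> p\<^sup>2\<close>. Bounding \<open>2 ^ s\<close> by \<open>m\<^sup>2\<close> absorbs the rounding at every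
  prime, as this bound is multiplicative.
\<close>

lemma wl_refine_funpow_multiple:
  assumes n: "n > 0" and m: "m > 0" "coprime m n"
  shows "\<exists>s. 2 ^ s \<le> m\<^sup>2 \<and> (\<forall>E x y. equiv (Zn n) E \<longrightarrow> x \<in> Zn n \<longrightarrow> y \<in> Zn n \<longrightarrow>
    (int m * x mod int n, int m * y mod int n) \<in> (wl_refine n ^^ s) E \<longrightarrow> (x, y) \<in> E)"
  using m
proof (induction m rule: less_induct)
  case (less m)
  show ?case
  proof (cases "m = 1")
    case True
    then show ?thesis by (intro exI[of _ 0]) auto
  next
    case False
    then obtain p where p: "prime p" "p dvd m"
      using prime_factor_nat by blast
    then obtain m' where m': "m = p * m'" by (auto elim: dvdE)
    have p2: "p \<ge> 2" using p(1) by (simp add: prime_ge_2_nat)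
    have "coprime p n" "coprime m' n" "m' > 0" "m' < m"
      using less.prems m' p2 by auto
    then obtain s' where s': "2 ^ s' \<le> m'\<^sup>2"
      and rel': "\<And>E x y. equiv (Zn n) E \<Longrightarrow> x \<in> Zn n \<Longrightarrow> y \<in> Zn n \<Longrightarrow>
        (int m' * x mod int n, int m' * y mod int n) \<in> (wl_refine n ^^ s') E \<Longrightarrow> (x, y) \<in> E"
      using less.IH[of m'] by blast
    obtain i where i: "2 ^ i < p" "p \<le> 2 ^ (i + 1)"
      using ex_power_ivl2[of 2 p] p2 by auto
    have "2 ^ (i + 1) \<le> p\<^sup>2"
      using i(1) mult_mono[of 2 p "2 ^ i" p] p2 by (simp add: power2_eq_square)
    then have "2 ^ ((i + 1) + s') \<le> m\<^sup>2"
      unfolding power_add[of _ "i + 1"] m' power_mult_distrib using s' by (rule mult_mono) auto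
    moreover have "(x, y) \<in> E"
      if E: "equiv (Zn n) E" and xy: "x \<in> Zn n" "y \<in> Zn n"
        and rel: "(int m * x mod int n, int m * y mod int n) \<in> (wl_refine n ^^ ((i + 1) + s')) E" for E x y
    proof (rule rel'[OF E xy])
      have "(int p * (int m' * x mod int n) mod int n, int p * (int m' * y mod int n) mod int n)
          \<in> (wl_refine n ^^ (i + 1)) ((wl_refine n ^^ s') E)"
        using rel unfolding funpow_add by (simp add: m' mod_simps mult.assoc)
      then show "(int m' * x mod int n, int m' * y mod int n) \<in> (wl_refine n ^^ s') E"
        using wl_refine_funpow_prime_multiple[OF n equiv_wl_refine_funpow[OF E] p(1) \<open>coprime p n\<close> i(2)] n
        by simp
    qed
    ultimately show ?thesis by blast
  qed
qed

text \<open>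
  To see that \<open>m x\<close> and \<open>m y\<close> are equivalent, multiply them by an inverse of \<open>m\<close>: this leads back to
  \<open>x\<close> and \<open>y\<close>.
\<close>

lemma wl_refine_funpow_subset_unit_core:
  assumes n: "n > 0" and E: "equiv (Zn n) E"
  shows "(wl_refine n ^^ floor_log (n\<^sup>2)) E \<subseteq> unit_core n E"
proof
  fix z assume z: "z \<in> (wl_refine n ^^ floor_log (n\<^sup>2)) E"
  obtain x y where xy: "z = (x, y)" "x \<in> Zn n" "y \<in> Zn n"
    using z equiv_wl_refine_funpow[OF E, where n = n and k = "floor_log (n\<^sup>2)"]
    by (cases z) (auto simp: equiv_def)
  have "(m * x mod int n, m * y mod int n) \<in> E" if m: "coprime m (int n)" for m
  proof -
    obtain m0 where "[m * m0 = 1] (mod int n)"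
      using cong_solve_coprime_int[OF m] by auto
    \<comment> \<open>the representative in \<open>{1..n}\<close>, since multipliers have to be positive\<close>
    define m' where "m' = (if n = 1 then 1 else nat (m0 mod int n))"
    have inv: "[int m' * m = 1] (mod int n)"
      using \<open>[m * m0 = 1] (mod int n)\<close> n by (auto simp: m'_def cong_def mod_simps mult.commute)
    have cop: "coprime m' n"
      using inv coprime_iff_invertible_int[of "int m'" "int n"] by auto
    have "m' \<noteq> 0"
    proof
      assume "m' = 0"
      then have "n = 1" using cop by simp
      then show False using \<open>m' = 0\<close> by (simp add: m'_def)
    qed
    then have m': "0 < m'" by simp
    have "m' \<le> n"
      using n pos_mod_bound[of "int n" m0] by (simp add: m'_def nat_le_iff less_imp_le)
    obtain s where s: "2 ^ s \<le> m'\<^sup>2"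
      and rel: "\<And>E x y. equiv (Zn n) E \<Longrightarrow> x \<in> Zn n \<Longrightarrow> y \<in> Zn n \<Longrightarrow>
        (int m' * x mod int n, int m' * y mod int n) \<in> (wl_refine n ^^ s) E \<Longrightarrow> (x, y) \<in> E"
      using wl_refine_funpow_multiple[OF n m' cop] by blast
    have "2 ^ s \<le> n\<^sup>2"
      using s \<open>m' \<le> n\<close> by (meson le_trans power_mono zero_le)
    then have "s \<le> floor_log (n\<^sup>2)"
      using monoD[OF floor_log_mono] floor_log_power by metis
    then have "(x, y) \<in> (wl_refine n ^^ s) E"
      using z xy wl_refine_funpow_antimono by blast
    moreover have "int m' * (m * v mod int n) mod int n = v" if "v \<in> Zn n" for v
    proof -
      have "int m' * (m * v mod int n) mod int n = (int m' * m mod int n) * v mod int n"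
        by (simp add: mod_simps mult.assoc)
      also have "\<dots> = v mod int n"
        using inv by (simp add: cong_def mod_simps)
      finally show ?thesis using that by simp
    qed
    ultimately show ?thesis
      using rel[OF E, of "m * x mod int n" "m * y mod int n"] xy n by simp
  qed
  then show "z \<in> unit_core n E"
    using xy by (simp add: unit_core_def)
qed

section \<open>Chains of unit-invariant partitions\<close>

text \<open>
  The orbits of the units are represented by the divisors of \<open>n\<close>. Write \<open>y = d y'\<close> and \<open>n = d n'\<close>
  with \<open>d = gcd y n\<close>. The wanted unit is \<open>y' + n' t\<close>, where \<open>t\<close> is the product of the primes that
  divide \<open>n\<close> but not \<open>y'\<close>: each prime divisor of \<open>n\<close> then divides exactly one of the two summands.
\<close>

lemma ex_unit_multiple_of_gcd:
  assumes n: "n > 0"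
  shows "\<exists>m. coprime m (int n) \<and> [m * gcd y (int n) = y] (mod int n)"
proof -
  define d where "d = gcd y (int n)"
  have d: "d > 0" using n by (simp add: d_def)
  obtain y' n' where y': "y = y' * d" "int n = n' * d" "coprime y' n'"
    using gcd_coprime_exists[of y "int n"] d unfolding d_def by auto
  define T where "T = {q. prime q \<and> q dvd int n \<and> \<not> q dvd y'}"
  define t where "t = \<Prod>T"
  have "finite {q. q dvd int n}"
    using n by (simp add: finite_divisors_int)
  then have T: "finite T"
    by (rule finite_subset[rotated]) (auto simp: T_def)
  have dvd_t: "q dvd t \<longleftrightarrow> \<not> q dvd y'" if q: "prime q" "q dvd int n" for q
  proof
    assume "q dvd t"
    then obtain r where r: "r \<in> T" "q dvd r"
      unfolding t_def using prime_dvd_prod_iff[OF T q(1)] by auto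
    then have "q = r" using q(1) by (auto simp: T_def primes_dvd_imp_eq)
    then show "\<not> q dvd y'" using r(1) by (simp add: T_def)
  next
    assume "\<not> q dvd y'"
    then show "q dvd t"
      unfolding t_def using T q by (intro dvd_prodI) (auto simp: T_def)
  qed
  have "\<not> q dvd y' + n' * t" if q: "prime q" "q dvd int n" for q
  proof (cases "q dvd y'")
    case True
    then have "\<not> q dvd n'"
      using y'(3) q(1) not_prime_unit coprime_common_divisor by blast
    moreover have "\<not> q dvd t" using True dvd_t[OF q] by simp
    ultimately show ?thesis
      using True q(1) by (simp add: dvd_add_right_iff prime_dvd_mult_iff)
  next
    case False
    then show ?thesis using dvd_t[OF q] by (simp add: dvd_add_left_iff)
  qed
  moreover have "gcd (y' + n' * t) (int n) \<noteq> 0" using n by simp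
  ultimately have "is_unit (gcd (y' + n' * t) (int n))"
    using prime_divisor_exists[of "gcd (y' + n' * t) (int n)"] by (metis gcd_greatest_iff)
  then have "coprime (y' + n' * t) (int n)"
    by (simp add: coprime_iff_gcd_eq_1)
  moreover have "[(y' + n' * t) * d = y] (mod int n)"
    unfolding y'(1) y'(2) by (simp add: cong_iff_dvd_diff algebra_simps)
  ultimately show ?thesis
    unfolding d_def by blast
qed

lemma finite_class: "equiv (Zn n) E \<Longrightarrow> finite (E `` {x})"
  by (rule finite_subset[of _ "Zn n"]) (auto simp: equiv_def)

lemma card_class_unit_multiple:
  assumes n: "n > 0" and E: "equiv (Zn n) E" and inv: "unit_invariant n E"
    and m: "coprime m (int n)" "[m * x = y] (mod int n)" and "x \<in> Zn n" "y \<in> Zn n"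
  shows "card (E `` {y}) = card (E `` {x})"
proof -
  have le: "card (E `` {x}) \<le> card (E `` {m * x mod int n})"
    if m: "coprime m (int n)" for m x
  proof (rule card_inj_on_le)
    have "E `` {x} \<subseteq> Zn n"
      using E by (auto simp: equiv_def)
    then show "inj_on (\<lambda>v. m * v mod int n) (E `` {x})"
      using bij_betw_mult_mod[OF n m] by (auto simp: bij_betw_def intro: inj_on_subset)
    show "(\<lambda>v. m * v mod int n) ` (E `` {x}) \<subseteq> E `` {m * x mod int n}"
      using inv m by (auto simp: unit_invariant_def)
  qed (rule finite_class[OF E])
  obtain m' where inv': "[m * m' = 1] (mod int n)"
    using cong_solve_coprime_int[OF m(1)] by auto
  then have "coprime m' (int n)"
    using coprime_iff_invertible_int[of m' "int n"] by (auto simp: mult.commute)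
  have y: "y = m * x mod int n"
    using assms(6,7) m(2) by (auto simp: cong_def)
  have "m' * y mod int n = (m * m') * x mod int n"
    unfolding y by (simp add: mod_simps algebra_simps)
  also have "\<dots> = x"
    using inv' assms(6) cong_scalar_right[of "m * m'" 1 "int n" x] by (simp add: cong_def)
  finally show ?thesis
    using le[OF m(1), of x] le[OF \<open>coprime m' (int n)\<close>, of y] y by simp
qed

text \<open>
  A divisor \<open>d\<close> of \<open>n\<close> stands for its orbit under the units; the reduction modulo \<open>n\<close> only matters
  for \<open>d = n\<close>, which represents the orbit of 0.
\<close>

definition class_potential :: "nat \<Rightarrow> (int \<times> int) set \<Rightarrow> nat" where
  "class_potential n E = (\<Sum>d | d dvd n. floor_log (card (E `` {int d mod int n})))"

lemma class_potential_le:
  assumes n: "n > 0" and E: "equiv (Zn n) E"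
  shows "class_potential n E \<le> card {d. d dvd n} * floor_log n"
proof -
  have "card (E `` {x}) \<le> n" for x
    using card_mono[of "Zn n" "E `` {x}"] E by (auto simp: equiv_def)
  then show ?thesis
    unfolding class_potential_def
    by (intro sum_bounded_above[where K = "floor_log n", simplified]) (auto intro: monoD[OF floor_log_mono])
qed

text \<open>
  A class of \<open>E\<close> that is not a class of \<open>F\<close> contains two classes of \<open>F\<close>, one of which has at most
  half its size. The class sizes at the representative of that orbit are the same by invariance, so
  the summand for this orbit drops by at least one. No summand grows.
\<close>

lemma class_potential_strict_mono:
  assumes n: "n > 0" and E: "equiv (Zn n) E" "unit_invariant n E"
    and F: "equiv (Zn n) F" "unit_invariant n F" and sub: "F \<subset> E"
  shows "class_potential n F < class_potential n E"
proof -
  obtain x x' where x: "(x, x') \<in> E" "(x, x') \<notin> F" using sub by auto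
  then have Zn: "x \<in> Zn n" "x' \<in> Zn n" using E(1) by (auto simp: equiv_def)
  have "F `` {x} \<inter> F `` {x'} = {}"
    using equiv_class_nondisjoint[OF F(1)] x(2) by blast
  moreover have "F `` {x} \<union> F `` {x'} \<subseteq> E `` {x}" "E `` {x'} = E `` {x}"
    using sub equiv_class_eq[OF E(1) x(1)] by auto
  ultimately have "card (F `` {x}) + card (F `` {x'}) \<le> card (E `` {x})"
    using card_mono[OF finite_class[OF E(1)]] by (metis card_Un_disjoint finite_class[OF F(1)])
  then have "2 * card (F `` {x}) \<le> card (E `` {x}) \<or> 2 * card (F `` {x'}) \<le> card (E `` {x'})"
    unfolding \<open>E `` {x'} = E `` {x}\<close> by linarith
  then obtain y where y: "y \<in> Zn n" "2 * card (F `` {y}) \<le> card (E `` {y})"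
    using Zn by blast
  define d where "d = nat (gcd y (int n))"
  have d: "d dvd n" "int d = gcd y (int n)"
  proof -
    show d: "int d = gcd y (int n)" by (simp add: d_def)
    show "d dvd n" unfolding of_nat_dvd_iff[where ?'a = int, symmetric] d by simp
  qed
  obtain m where m: "coprime m (int n)" "[m * int d = y] (mod int n)"
    using ex_unit_multiple_of_gcd[OF n, of y] d(2) by auto
  then have "[m * (int d mod int n) = y] (mod int n)"
    by (simp add: cong_def mod_simps)
  then have "2 * card (F `` {int d mod int n}) \<le> card (E `` {int d mod int n})"
    using y card_class_unit_multiple[OF n E m(1), of "int d mod int n" y]
      card_class_unit_multiple[OF n F m(1), of "int d mod int n" y] n by simp
  moreover have "card (F `` {int d mod int n}) > 0"
    using finite_class[OF F(1)] equiv_class_self[OF F(1), of "int d mod int n"] n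
    by (auto simp: card_gt_0_iff)
  ultimately have "floor_log (card (F `` {int d mod int n})) < floor_log (card (E `` {int d mod int n}))"
    using monoD[OF floor_log_mono] floor_log_twice by (metis Suc_le_eq not_gr0)
  moreover have "floor_log (card (F `` {v})) \<le> floor_log (card (E `` {v}))" for v
    using sub by (intro monoD[OF floor_log_mono] card_mono finite_class[OF E(1)]) auto
  ultimately show ?thesis
    unfolding class_potential_def using d(1) n
    by (intro sum_strict_mono_ex1) auto
qed

lemma wl_refine_stabilizes_unit_invariant:
  assumes n: "n > 0" and "equiv (Zn n) E" "unit_invariant n E"
  shows "\<exists>k \<le> class_potential n E. wl_refine n ((wl_refine n ^^ k) E) = (wl_refine n ^^ k) E"
  using assms(2-)
proof (induction "class_potential n E" arbitrary: E rule: less_induct)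
  case less
  show ?case
  proof (cases "wl_refine n E = E")
    case True
    then show ?thesis by (intro exI[of _ 0]) simp
  next
    case False
    let ?E = "wl_refine n E"
    have E': "equiv (Zn n) ?E" "unit_invariant n ?E"
      using less.prems equiv_wl_refine unit_invariant_wl_refine[OF n] by auto
    have lt: "class_potential n ?E < class_potential n E"
      using False wl_refine_subset[of n E] by (intro class_potential_strict_mono n less.prems E') auto
    from less.hyps[OF this E'] obtain k where
      "k \<le> class_potential n ?E" "wl_refine n ((wl_refine n ^^ k) ?E) = (wl_refine n ^^ k) ?E"
      by blast
    with lt show ?thesis
      by (intro exI[of _ "Suc k"]) (simp add: funpow_swap1)
  qed
qed

text \<open>
  With \<open>C\<close> the unit core of \<open>E\<close>, the iterates of \<open>E\<close> and of \<open>C\<close> interlace: the one of \<open>E\<close> after \<open>k + L\<close>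
  rounds lies below the one of \<open>C\<close> after \<open>k\<close> rounds, and, once the latter is stable, this lies below
  the one of \<open>E\<close> after any number of rounds.
\<close>

lemma wl_refine_stabilizes:
  assumes n: "n > 0" and E: "equiv (Zn n) E"
  shows "\<exists>r \<le> card {d. d dvd n} * floor_log n + floor_log (n\<^sup>2).
    wl_refine n ((wl_refine n ^^ r) E) = (wl_refine n ^^ r) E"
proof -
  define L where "L = floor_log (n\<^sup>2)"
  define C where "C = unit_core n E"
  have C: "equiv (Zn n) C" "unit_invariant n C"
    unfolding C_def using equiv_unit_core[OF n E] unit_invariant_unit_core[OF n] by auto
  obtain k where k: "k \<le> class_potential n C" "wl_refine n ((wl_refine n ^^ k) C) = (wl_refine n ^^ k) C"
    using wl_refine_stabilizes_unit_invariant[OF n C] by blast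
  have fixed: "(wl_refine n ^^ j) ((wl_refine n ^^ k) C) = (wl_refine n ^^ k) C" for j
    by (induction j) (simp_all add: k(2))
  have "(wl_refine n ^^ (k + L)) E \<subseteq> (wl_refine n ^^ k) C"
    unfolding funpow_add comp_def C_def L_def
    by (intro wl_refine_funpow_mono wl_refine_funpow_subset_unit_core n E)
  also have "\<dots> = (wl_refine n ^^ (Suc L + k)) C"
    unfolding funpow_add comp_def fixed ..
  also have "\<dots> \<subseteq> (wl_refine n ^^ (Suc L + k)) E"
    unfolding C_def by (intro wl_refine_funpow_mono unit_core_subset)
  also have "\<dots> = wl_refine n ((wl_refine n ^^ (k + L)) E)"
    by (simp add: add.commute)
  finally have "wl_refine n ((wl_refine n ^^ (k + L)) E) = (wl_refine n ^^ (k + L)) E"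
    using wl_refine_subset by blast
  moreover have "k + L \<le> card {d. d dvd n} * floor_log n + floor_log (n\<^sup>2)"
    using k(1) class_potential_le[OF n C(1)] by (simp add: L_def)
  ultimately show ?thesis by blast
qed

lemma wl_steps_circulant_le:
  assumes n: "n > 0" and G: "circulant_graph n G"
  shows "wl_steps G \<le> card {d. d dvd n} * floor_log n + floor_log (n\<^sup>2)"
proof -
  obtain S where S: "S \<subseteq> Zn n" and G_eq: "G = cayley_graph (integer_mod_group n) S"
    using G n by (auto simp: circulant_graph_def carrier_integer_mod_group)
  define E where "E = kernel_rel (Zn n) (\<lambda>x. wl_coloring G 0 (0, x))"
  have V: "pverts G = Zn n"
    using n by (simp add: G_eq cayley_graph_def carrier_integer_mod_group)
  obtain r where r: "r \<le> card {d. d dvd n} * floor_log n + floor_log (n\<^sup>2)"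
    "wl_refine n ((wl_refine n ^^ r) E) = (wl_refine n ^^ r) E"
    using wl_refine_stabilizes[OF n equiv_kernel] unfolding E_def by blast
  have col: "wl_coloring G k (v1, v2) = wl_coloring G k (w1, w2) \<longleftrightarrow>
      ((v2 - v1) mod int n, (w2 - w1) mod int n) \<in> (wl_refine n ^^ k) E"
    if "v1 \<in> Zn n" "v2 \<in> Zn n" "w1 \<in> Zn n" "w2 \<in> Zn n" for k v1 v2 w1 w2
    using wl_coloring_circulant[OF n S that] unfolding E_def G_eq .
  have "wl_coloring G (Suc r) q = wl_coloring G (Suc r) p \<longleftrightarrow> wl_coloring G r q = wl_coloring G r p"
    if "p \<in> Zn n \<times> Zn n" "q \<in> Zn n \<times> Zn n" for p q
  proof -
    obtain v1 v2 w1 w2 where pq: "p = (v1, v2)" "q = (w1, w2)" by (cases p, cases q)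
    have "(wl_refine n ^^ Suc r) E = (wl_refine n ^^ r) E" using r(2) by simp
    then show ?thesis
      using that unfolding pq by (simp only: mem_Sigma_iff col)
  qed
  then have "wl_partition G (Suc r) = wl_partition G r"
    unfolding wl_partition_def V by (intro image_cong refl Collect_cong) blast
  then have "wl_steps G \<le> r"
    unfolding wl_steps_def by (rule Least_le)
  with r(1) show ?thesis by simp
qed

lemma floor_log_le_log: "n > 0 \<Longrightarrow> real (floor_log n) \<le> log 2 (real n)"
  using floor_log_exp2_le[of n] by (intro le_log_of_power) (simp_all flip: of_nat_le_iff)

theorem theorem1:
  shows "\<exists>C::real. C > 0 \<and>
    (\<forall>(n::nat) (G :: int pair_pre_digraph). n > 0 \<longrightarrow> circulant_graph n G \<longrightarrow>
       real (wl_steps G) \<le> C * real (card {d::nat. d dvd n}) * ln (real n))"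
proof (intro exI conjI allI impI)
  show "3 / ln 2 > (0::real)" by simp
  fix n :: nat and G :: "int pair_pre_digraph"
  assume n: "n > 0" and G: "circulant_graph n G"
  let ?D = "card {d. d dvd n}"
  \<comment> \<open>\<open>d(n) \<ge> 1\<close> lets the \<open>2 log n\<close> rounds needed for invariance be absorbed into the constant 3\<close>
  have "{1} \<subseteq> {d. d dvd n}" by auto
  then have D: "?D \<ge> 1"
    using card_mono[of "{d. d dvd n}" "{1}"] n by simp
  have log: "log 2 (real n) \<ge> 0" using n by simp
  have "real (wl_steps G) \<le> real (?D * floor_log n + floor_log (n\<^sup>2))"
    using wl_steps_circulant_le[OF n G] by (simp only: of_nat_le_iff)
  also have "\<dots> \<le> real ?D * log 2 n + 2 * log 2 n"
    using floor_log_le_log[OF n] floor_log_le_log[of "n\<^sup>2"] n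
    by (simp add: log_nat_power add_mono mult_left_mono)
  also have "\<dots> \<le> real ?D * log 2 n + 2 * (real ?D * log 2 n)"
    using D log mult_right_mono[of 1 "real ?D" "log 2 n"]
    by (simp add: mult.commute)
  also have "\<dots> = 3 / ln 2 * real ?D * ln n"
    by (simp add: log_def)
  finally show "real (wl_steps G) \<le> 3 / ln 2 * real ?D * ln n" .
qed

end
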